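(* Let $F\subset\mathbb{P}^2_{\mathbb{C}}$ be the Fermat cubic $x^3+y^3+z^3=0$. For any type $9$ point $T\in F$, the residual intersection point of $F$ with the line tangent to $F$ at $T$ is another point of type $9$ (that is, a type $9$ point different from $T$).
   Context: Equip the smooth plane cubic $F$ with its group law having a flex point as origin, so that three points of $F$ sum to zero if and only if they are the intersection (with multiplicity) of $F$ with a line. The flex points are then exactly the points $P$ with $3P=0$. A type $9$ point on $F$ is a point $P\in F$ that is $9$-torsion but not $3$-torsion ($9P=0$, $3P\neq 0$); this does not depend on the choice of flex as origin. If $P\in F$ is not a flex, the tangent line to $F$ at $P$ meets $F$ at $P$ with multiplicity $2$ and at exactly one further point, called the residual intersection point. *)

theory Defs
  imports "HOL-Analysis.Analysis" "HOL-Computational_Algebra.Polynomial" "HOL-Library.Multiset"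
    "HOL-Algebra.Group"
begin

quotient_type cp2 = "complex^3" / partial: "\<lambda>u v. u \<noteq> 0 \<and> v \<noteq> 0 \<and> (\<exists>c. u = c *s v)"
proof (rule part_equivpI)
  show "\<exists>x::complex^3. x \<noteq> 0 \<and> x \<noteq> 0 \<and> (\<exists>c. x = c *s x)"
    by (metis vector_smult_lid zero_neq_one)
  show "symp (\<lambda>u v :: complex^3. u \<noteq> 0 \<and> v \<noteq> 0 \<and> (\<exists>c. u = c *s v))"
  proof (rule sympI)
    fix u v :: "complex^3"
    assume *: "u \<noteq> 0 \<and> v \<noteq> 0 \<and> (\<exists>c. u = c *s v)"
    then obtain c where "u = c *s v" "c \<noteq> 0" by auto
    then have "v = inverse c *s u" by (simp add: vector_smult_assoc)
    then show "v \<noteq> 0 \<and> u \<noteq> 0 \<and> (\<exists>c. v = c *s u)" using * by blast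
  qed
  show "transp (\<lambda>u v :: complex^3. u \<noteq> 0 \<and> v \<noteq> 0 \<and> (\<exists>c. u = c *s v))"
    by (rule transpI) (metis vector_smult_assoc)
qed

text \<open>A line is given by its coefficient vector up to scaling.\<close>

type_synonym line = cp2

lift_definition on_line :: "cp2 \<Rightarrow> line \<Rightarrow> bool"
  is "\<lambda>v a. (\<Sum>i\<in>UNIV. a $ i * v $ i) = 0"
proof -
  fix u v a b :: "complex^3"
  assume "u \<noteq> 0 \<and> v \<noteq> 0 \<and> (\<exists>c. u = c *s v)" "a \<noteq> 0 \<and> b \<noteq> 0 \<and> (\<exists>c. a = c *s b)"
  then obtain c d where *: "u = c *s v" "a = d *s b" "c \<noteq> 0" "d \<noteq> 0"
    by auto
  have "(\<Sum>i\<in>UNIV. a $ i * u $ i) = c * d * (\<Sum>i\<in>UNIV. b $ i * v $ i)"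
    by (simp add: * sum_distrib_left mult_ac)
  then show "((\<Sum>i\<in>UNIV. a $ i * u $ i) = 0) = ((\<Sum>i\<in>UNIV. b $ i * v $ i) = 0)"
    using * by simp
qed

lift_definition on_fermat :: "cp2 \<Rightarrow> bool"
  is "\<lambda>v. v $ 1 ^ 3 + v $ 2 ^ 3 + v $ 3 ^ 3 = 0"
proof -
  fix u v :: "complex^3"
  assume "u \<noteq> 0 \<and> v \<noteq> 0 \<and> (\<exists>c. u = c *s v)"
  then obtain c where *: "u = c *s v" "c \<noteq> 0"
    by auto
  have "u $ 1 ^ 3 + u $ 2 ^ 3 + u $ 3 ^ 3 = c ^ 3 * (v $ 1 ^ 3 + v $ 2 ^ 3 + v $ 3 ^ 3)"
    by (simp add: * algebra_simps power_mult_distrib)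
  then show "(u $ 1 ^ 3 + u $ 2 ^ 3 + u $ 3 ^ 3 = 0) = (v $ 1 ^ 3 + v $ 2 ^ 3 + v $ 3 ^ 3 = 0)"
    using * by simp
qed

definition fermat :: "cp2 set" where
  "fermat = {P. on_fermat P}"

text \<open>The coefficients of the tangent line at \<open>v\<close> are the partial derivatives of
  \<open>x\<^sup>3 + y\<^sup>3 + z\<^sup>3\<close> at \<open>v\<close>.\<close>

lift_definition tangent :: "cp2 \<Rightarrow> line"
  is "\<lambda>v. \<chi> i. 3 * v $ i ^ 2"
proof -
  fix u v :: "complex^3"
  assume *: "u \<noteq> 0 \<and> v \<noteq> 0 \<and> (\<exists>c. u = c *s v)"
  then obtain c where c: "u = c *s v" by blast
  have "(\<chi> i. 3 * u $ i ^ 2) = c\<^sup>2 *s (\<chi> i. 3 * v $ i ^ 2)"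
    by (simp add: c vec_eq_iff power_mult_distrib)
  then show "(\<chi> i. 3 * u $ i ^ 2) \<noteq> 0 \<and> (\<chi> i. 3 * v $ i ^ 2) \<noteq> 0 \<and>
      (\<exists>c. (\<chi> i. 3 * u $ i ^ 2) = c *s (\<chi> i. 3 * v $ i ^ 2))"
    using * by (auto simp: vec_eq_iff)
qed

text \<open>The order of vanishing at \<open>t = 0\<close> of \<open>x\<^sup>3 + y\<^sup>3 + z\<^sup>3\<close> restricted to the parametrised
  line \<open>u + t v\<close>.\<close>

lift_definition vanishing_order :: "cp2 \<Rightarrow> cp2 \<Rightarrow> nat"
  is "\<lambda>u v. order 0 ([:u $ 1, v $ 1:] ^ 3 + [:u $ 2, v $ 2:] ^ 3 + [:u $ 3, v $ 3:] ^ 3)"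
proof -
  fix u u' v v' :: "complex^3"
  assume "u \<noteq> 0 \<and> u' \<noteq> 0 \<and> (\<exists>c. u = c *s u')" "v \<noteq> 0 \<and> v' \<noteq> 0 \<and> (\<exists>c. v = c *s v')"
  then obtain c d where cd: "u = c *s u'" "v = d *s v'" "c \<noteq> 0" "d \<noteq> 0" by auto
  define F where "F u v = [:u $ 1, v $ 1:] ^ 3 + [:u $ 2, v $ 2:] ^ 3 + [:u $ 3, v $ 3:] ^ 3"
    for u v :: "complex^3"
  have "F u v = smult (c ^ 3) (pcompose (F u' v') [:0, d / c:])"
    using cd by (simp add: F_def pcompose_add pcompose_pCons power3_eq_cube pcompose_mult
        algebra_simps)
  moreover have "order 0 (pcompose p [:0, e:]) = order 0 p" if "e \<noteq> 0" for e :: complex and p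
  proof -
    have "[:- 0, 1:] ^ n = monom (1::complex) n" for n by (simp add: monom_altdef)
    then show ?thesis
      using that by (simp only: order_def monom_1_dvd_iff' coeff_pcompose_linear) simp
  qed
  ultimately have "order 0 (F u v) = order 0 (F u' v')"
    using cd by (simp add: order_smult)
  then show "order 0 ([:u $ 1, v $ 1:] ^ 3 + [:u $ 2, v $ 2:] ^ 3 + [:u $ 3, v $ 3:] ^ 3) =
      order 0 ([:u' $ 1, v' $ 1:] ^ 3 + [:u' $ 2, v' $ 2:] ^ 3 + [:u' $ 3, v' $ 3:] ^ 3)"
    by (simp add: F_def)
qed

text \<open>The value does not depend on the auxiliary point \<open>Q\<close>, and is finite because the cubic
  contains no line.\<close>

definition int_mult :: "line \<Rightarrow> cp2 \<Rightarrow> nat" where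
  "int_mult l P = (if on_line P l
     then THE n. \<forall>Q. on_line Q l \<and> Q \<noteq> P \<longrightarrow> vanishing_order P Q = n else 0)"

definition cut_by_line :: "cp2 \<Rightarrow> cp2 \<Rightarrow> cp2 \<Rightarrow> bool" where
  "cut_by_line P Q R \<longleftrightarrow> (\<exists>l. \<forall>X. int_mult l X = count {#P, Q, R#} X)"

definition third :: "cp2 \<Rightarrow> cp2 \<Rightarrow> cp2" where
  "third P Q = (THE R. cut_by_line P Q R)"

definition flex :: "cp2 \<Rightarrow> bool" where
  "flex P \<longleftrightarrow> P \<in> fermat \<and> (\<exists>l. int_mult l P \<ge> 3)"

text \<open>With a flex \<open>E\<close> as origin, the chord-tangent operation below is the group law for which three
  points sum to \<open>E\<close> iff they are the intersection, with multiplicity, of the cubic with a line.\<close>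

definition fermat_group :: "cp2 \<Rightarrow> cp2 monoid" where
  "fermat_group E = \<lparr>carrier = fermat, mult = (\<lambda>P Q. third E (third P Q)), one = E\<rparr>"

definition type9 :: "cp2 \<Rightarrow> cp2 \<Rightarrow> bool" where
  "type9 E P \<longleftrightarrow> P \<in> carrier (fermat_group E) \<and>
     P [^]\<^bsub>fermat_group E\<^esub> (9::nat) = \<one>\<^bsub>fermat_group E\<^esub> \<and>
     P [^]\<^bsub>fermat_group E\<^esub> (3::nat) \<noteq> \<one>\<^bsub>fermat_group E\<^esub>"

definition residual :: "cp2 \<Rightarrow> cp2" where
  "residual P = (THE R. R \<in> fermat \<and> on_line R (tangent P) \<and> R \<noteq> P)"

end

theory Submission
  imports Defs
begin

text \<open>In the group of the cubic, the line tangent at \<open>T\<close> meets the curve in \<open>T\<close>, \<open>T\<close> and a third point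
\<open>R\<close> with \<open>T + T + R = 0\<close>, so \<open>R = - 2 T\<close>. If \<open>9 T = 0\<close> and \<open>3 T \<noteq> 0\<close>, then \<open>9 R = 0\<close>, and
\<open>3 R = - 6 T = 3 T \<noteq> 0\<close>; and \<open>R = T\<close> would say \<open>3 T = 0\<close>. The substance is that the chord-tangent
operation is a group law, above all that it is associative.

The operation \<^term>\<open>third\<close> is defined by intersection multiplicities. It is given by explicit
polynomial formulas: \<open>chord\<close> for distinct points, \<open>tangential\<close> for equal ones (lemmas
\<open>third_chord\<close>, \<open>third_tangential\<close>). Associativity is then a polynomial identity modulo the
equation of the curve. With the chord formula this identity would be very large, and it would say
nothing about the cases that involve a tangent. The entries of Sylvester's
formula \<open>p\<^sub>i\<^sup>2 q\<^sub>j q\<^sub>k - q\<^sub>i\<^sup>2 p\<^sub>j p\<^sub>k\<close> for the third point are binomials, and with it associativity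
becomes a short identity (\<open>sylvester_assoc\<close>).

Sylvester's formula gives the zero vector when the two points differ by an element of a subgroup
of order \<open>3\<close>. The cyclic permutation of the coordinates is a translation by a \<open>3\<close>-torsion point
outside that subgroup: it satisfies \<open>third (rot P) Q = rot (rot (third P Q))\<close> (lemma \<open>third_rot\<close>).
Both sides of the associative law change in the same way when one of the three points is
translated, so the points can be translated until none of the four formulas involved vanishes
(lemma \<open>associates\<close>). Since a translation separates
equal points, this covers the tangent cases as well.\<close>

section \<open>Points in homogeneous coordinates\<close>

abbreviation pt :: "complex^3 \<Rightarrow> cp2" where
  "pt \<equiv> abs_cp2"

lemma ex_pt: obtains v where "v \<noteq> 0" "P = pt v"
proof -
  have "Quotient (\<lambda>u v :: complex^3. u \<noteq> 0 \<and> v \<noteq> 0 \<and> (\<exists>c. u = c *s v)) abs_cp2 rep_cp2 cr_cp2"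
    by (rule Quotient_cp2)
  then show ?thesis
    using that[of "rep_cp2 P"] Quotient_abs_rep Quotient_rep_reflp by fastforce
qed

text \<open>The relation that defines the projective plane is partial; this is the reflexivity premise of the
equations for lifted constants.\<close>

lemma pt_refl: "\<exists>c. v = c *s (v :: complex^3)"
  by (rule exI[of _ 1]) simp

lemma pt_eq_iff_smult:
  assumes "u \<noteq> 0" "v \<noteq> 0"
  shows "pt u = pt v \<longleftrightarrow> (\<exists>c. u = c *s v)"
  using Quotient_rel[OF Quotient_cp2, of u v] assms pt_refl by auto

lemma vec3_eq_iff: "(u :: complex^3) = v \<longleftrightarrow> u$1 = v$1 \<and> u$2 = v$2 \<and> u$3 = v$3"
  by (simp add: vec_eq_iff forall_3)

definition parallel :: "complex^3 \<Rightarrow> complex^3 \<Rightarrow> bool" where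
  "parallel u v \<longleftrightarrow> u$1 * v$2 = u$2 * v$1 \<and> u$2 * v$3 = u$3 * v$2 \<and> u$3 * v$1 = u$1 * v$3"

lemma parallel_commute: "parallel u v \<longleftrightarrow> parallel v u"
  by (auto simp: parallel_def mult.commute[of "u $ _"])

lemma parallel_imp_smult:
  assumes "parallel u v" "v \<noteq> 0"
  obtains c where "u = c *s v"
proof -
  obtain i where i: "v$i \<noteq> 0" using assms by (auto simp: vec_eq_iff)
  have "\<forall>i j. u$i * v$j = u$j * v$i"
    unfolding forall_3 using assms(1) by (auto simp: parallel_def mult.commute[of "v $ _"])
  then have "u = (u$i / v$i) *s v"
    using i by (simp add: vec_eq_iff field_simps)
  then show thesis ..
qed

lemma pt_eq_iff:
  assumes "u \<noteq> 0" "v \<noteq> 0"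
  shows "pt u = pt v \<longleftrightarrow> parallel u v"
  using assms parallel_imp_smult[of u v] by (auto simp: pt_eq_iff_smult parallel_def)

lemma pt_smult: "c \<noteq> 0 \<Longrightarrow> v \<noteq> 0 \<Longrightarrow> pt (c *s v) = pt v"
  by (simp add: pt_eq_iff parallel_def)

text \<open>The symmetric trilinear form with \<open>polar v v v = v\<^sub>1\<^sup>3 + v\<^sub>2\<^sup>3 + v\<^sub>3\<^sup>3\<close>. All intersection
multiplicities can be read off from its values.\<close>

definition polar :: "complex^3 \<Rightarrow> complex^3 \<Rightarrow> complex^3 \<Rightarrow> complex" where
  "polar u v w = u$1 * v$1 * w$1 + u$2 * v$2 * w$2 + u$3 * v$3 * w$3"

lemma fermat_pt: "v \<noteq> 0 \<Longrightarrow> pt v \<in> fermat \<longleftrightarrow> polar v v v = 0"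
  unfolding fermat_def polar_def using pt_refl[of v] by (simp add: on_fermat.abs_eq power3_eq_cube)

section \<open>Lines and intersection multiplicities\<close>

lemma polar_combine:
  "polar (s *s u + t *s v) (s *s u + t *s v) (s *s u + t *s v) =
    s^3 * polar u u u + 3 * s^2 * t * polar u u v + 3 * s * t^2 * polar u v v + t^3 * polar v v v"
  unfolding polar_def by simp algebra

lemma on_line_pt:
  "v \<noteq> 0 \<Longrightarrow> a \<noteq> 0 \<Longrightarrow> on_line (pt v) (pt a) \<longleftrightarrow> a$1 * v$1 + a$2 * v$2 + a$3 * v$3 = 0"
  using pt_refl[of v] pt_refl[of a] by (simp add: on_line.abs_eq sum_3)

lemma vanishing_order_pt:
  assumes "u \<noteq> 0" "v \<noteq> 0"
  shows "vanishing_order (pt u) (pt v) =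
    order 0 [:polar u u u, 3 * polar u u v, 3 * polar u v v, polar v v v:]"
proof -
  have "[:u$1, v$1:]^3 + [:u$2, v$2:]^3 + [:u$3, v$3:]^3 =
      [:polar u u u, 3 * polar u u v, 3 * polar u v v, polar v v v:]"
    unfolding polar_def by (simp add: power3_eq_cube algebra_simps)
  then show ?thesis
    using pt_refl[of u] pt_refl[of v] assms by (simp add: vanishing_order.abs_eq)
qed

lemma order_0_pCons_0: "p \<noteq> 0 \<Longrightarrow> order 0 (pCons 0 p) = Suc (order 0 p)"
  for p :: "complex poly"
proof -
  assume "p \<noteq> 0"
  have "order 0 [:0, 1 :: complex:] = 1"
    using order_power_n_n[of "0::complex" 1] by simp
  moreover have "pCons 0 p = [:0, 1:] * p" by simp
  ultimately show ?thesis
    using \<open>p \<noteq> 0\<close> order_mult[of "[:0, 1:]" p 0] by simp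
qed

lemma order_0_cubic:
  fixes a b c d :: complex
  assumes "a \<noteq> 0 \<or> b \<noteq> 0 \<or> c \<noteq> 0 \<or> d \<noteq> 0"
  shows "order 0 [:a, b, c, d:] = (if a \<noteq> 0 then 0 else if b \<noteq> 0 then 1 else if c \<noteq> 0 then 2 else 3)"
proof -
  have unit: "order 0 (pCons e p) = 0" if "e \<noteq> 0" for e :: complex and p
    using that by (simp add: order_0I)
  show ?thesis
    using assms by (auto simp: unit order_0_pCons_0)
qed

definition cross :: "complex^3 \<Rightarrow> complex^3 \<Rightarrow> complex^3" where
  "cross u v = vector [u$2 * v$3 - u$3 * v$2, u$3 * v$1 - u$1 * v$3, u$1 * v$2 - u$2 * v$1]"

lemma cross_eq_0_iff: "cross u v = 0 \<longleftrightarrow> parallel u v"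
  by (auto simp: cross_def parallel_def vec3_eq_iff)

lemma orthogonal_parallel_cross:
  assumes "w$1 * u$1 + w$2 * u$2 + w$3 * u$3 = 0" "w$1 * v$1 + w$2 * v$2 + w$3 * v$3 = 0"
  shows "parallel w (cross u v)"
proof -
  have "w$1 * (u$3 * v$1 - u$1 * v$3) = w$2 * (u$2 * v$3 - u$3 * v$2)"
    "w$2 * (u$1 * v$2 - u$2 * v$1) = w$3 * (u$3 * v$1 - u$1 * v$3)"
    "w$3 * (u$2 * v$3 - u$3 * v$2) = w$1 * (u$1 * v$2 - u$2 * v$1)"
    using assms by algebra+
  then show ?thesis by (simp add: parallel_def cross_def)
qed

text \<open>Both \<open>w\<close> and \<open>w'\<close> are multiples of the cross product of \<open>u\<close> and \<open>v\<close>. Read with \<open>w\<close>, \<open>w'\<close> as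
lines, this is the uniqueness of the line through two points.\<close>

lemma orthogonal_parallel:
  assumes "\<not> parallel u v"
    and "w$1 * u$1 + w$2 * u$2 + w$3 * u$3 = 0" "w$1 * v$1 + w$2 * v$2 + w$3 * v$3 = 0"
    and "w'$1 * u$1 + w'$2 * u$2 + w'$3 * u$3 = 0" "w'$1 * v$1 + w'$2 * v$2 + w'$3 * v$3 = 0"
  shows "parallel w w'"
proof -
  obtain c c' where "w = c *s cross u v" "w' = c' *s cross u v"
    using assms orthogonal_parallel_cross parallel_imp_smult by (metis cross_eq_0_iff)
  then show ?thesis by (simp add: parallel_def)
qed

text \<open>The differences of the two sides of the hypotheses are divisible by the minor \<open>a d - b c\<close>, with
cofactors \<open>a b\<close>, \<open>a d + b c\<close> and \<open>c d\<close>. These can vanish together only if \<open>a d\<close> and \<open>b c\<close>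
are both \<open>0\<close>.\<close>

lemma minor_eq_0:
  fixes a b c d :: complex
  assumes "a * a * (b * d) = b * b * (a * c)" "a * a * (d * d) = b * b * (c * c)"
    "a * c * (d * d) = b * d * (c * c)"
  shows "a * d = b * c"
proof -
  have "(a * d - b * c) * (a * b) = 0" "(a * d - b * c) * (a * d + b * c) = 0"
    "(a * d - b * c) * (c * d) = 0"
    using assms by algebra+
  then show ?thesis by auto
qed

text \<open>The coordinatewise products \<open>u u\<close>, \<open>u v\<close> and \<open>v v\<close> are all orthogonal to \<open>u\<close> and \<open>v\<close>, because
the inner products in question are values of \<^term>\<open>polar\<close>. Hence they are pairwise parallel, and
\<open>minor_eq_0\<close> shows that every \<open>2 \<times> 2\<close> minor of \<open>u\<close>, \<open>v\<close> vanishes.\<close>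

lemma fermat_contains_no_line:
  assumes "\<not> parallel u v"
    and "polar u u u = 0" "polar u u v = 0" "polar u v v = 0" "polar v v v = 0"
  shows False
proof -
  define uu uv vv :: "complex^3"
    where "uu = (\<chi> i. u$i * u$i)" and "uv = (\<chi> i. u$i * v$i)" and "vv = (\<chi> i. v$i * v$i)"
  note defs = uu_def uv_def vv_def
  have orth: "uu$1 * u$1 + uu$2 * u$2 + uu$3 * u$3 = 0" "uu$1 * v$1 + uu$2 * v$2 + uu$3 * v$3 = 0"
    "uv$1 * u$1 + uv$2 * u$2 + uv$3 * u$3 = 0" "uv$1 * v$1 + uv$2 * v$2 + uv$3 * v$3 = 0"
    "vv$1 * u$1 + vv$2 * u$2 + vv$3 * u$3 = 0" "vv$1 * v$1 + vv$2 * v$2 + vv$3 * v$3 = 0"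
    using assms(2-) unfolding polar_def by (simp_all add: defs mult_ac)
  have "parallel uu uv" "parallel uu vv" "parallel uv vv"
    by (rule orthogonal_parallel[OF assms(1)]; fact orth)+
  note minors = this[unfolded parallel_def defs vec_lambda_beta]
  have "u$1 * v$2 = u$2 * v$1" "u$2 * v$3 = u$3 * v$2" "u$3 * v$1 = u$1 * v$3"
    by (rule minor_eq_0; use minors in blast)+
  then show False
    using assms(1) by (simp add: parallel_def)
qed

lemma line_spanned:
  fixes a p q r :: "complex^3"
  assumes "\<not> parallel p q" "a \<noteq> 0"
    and "a$1 * p$1 + a$2 * p$2 + a$3 * p$3 = 0" "a$1 * q$1 + a$2 * q$2 + a$3 * q$3 = 0"
      "a$1 * r$1 + a$2 * r$2 + a$3 * r$3 = 0"
  obtains s t where "r = s *s p + t *s q"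
proof -
  note spanned = that
  \<comment> \<open>The determinant of \<open>r\<close>, \<open>p\<close>, \<open>q\<close> vanishes since \<open>a\<close> is orthogonal to all three.\<close>
  define d where "d = r$1 * (p$2 * q$3 - p$3 * q$2) + r$2 * (p$3 * q$1 - p$1 * q$3)
    + r$3 * (p$1 * q$2 - p$2 * q$1)"
  have "a$1 * d = 0" "a$2 * d = 0" "a$3 * d = 0"
    unfolding d_def using assms(3-) by algebra+
  then have "d = 0"
    using \<open>a \<noteq> 0\<close> by (auto simp: vec3_eq_iff)
  then have det: "r$1 * (p$2 * q$3 - p$3 * q$2) + r$2 * (p$3 * q$1 - p$1 * q$3)
      + r$3 * (p$1 * q$2 - p$2 * q$1) = 0"
    by (simp add: d_def)
  have cramer: thesis
    if n: "n \<noteq> 0" and eq: "n * r$1 = s * p$1 + t * q$1" "n * r$2 = s * p$2 + t * q$2"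
      "n * r$3 = s * p$3 + t * q$3" for n s t
  proof -
    have "r = (s / n) *s p + (t / n) *s q"
      using n eq by (simp add: vec3_eq_iff field_simps)
    then show thesis by (rule spanned)
  qed
  consider "p$1 * q$2 - p$2 * q$1 \<noteq> 0" | "p$2 * q$3 - p$3 * q$2 \<noteq> 0" | "p$1 * q$3 - p$3 * q$1 \<noteq> 0"
    using assms(1) by (auto simp: parallel_def)
  then show thesis
  proof cases
    case 1
    have "(p$1 * q$2 - p$2 * q$1) * r$1 = (r$1 * q$2 - r$2 * q$1) * p$1 + (p$1 * r$2 - p$2 * r$1) * q$1"
      "(p$1 * q$2 - p$2 * q$1) * r$2 = (r$1 * q$2 - r$2 * q$1) * p$2 + (p$1 * r$2 - p$2 * r$1) * q$2"
      "(p$1 * q$2 - p$2 * q$1) * r$3 = (r$1 * q$2 - r$2 * q$1) * p$3 + (p$1 * r$2 - p$2 * r$1) * q$3"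
      using det by (simp_all add: algebra_simps)
    then show thesis by (rule cramer[OF 1])
  next
    case 2
    have "(p$2 * q$3 - p$3 * q$2) * r$1 = (r$2 * q$3 - r$3 * q$2) * p$1 + (p$2 * r$3 - p$3 * r$2) * q$1"
      "(p$2 * q$3 - p$3 * q$2) * r$2 = (r$2 * q$3 - r$3 * q$2) * p$2 + (p$2 * r$3 - p$3 * r$2) * q$2"
      "(p$2 * q$3 - p$3 * q$2) * r$3 = (r$2 * q$3 - r$3 * q$2) * p$3 + (p$2 * r$3 - p$3 * r$2) * q$3"
      using det by (simp_all add: algebra_simps)
    then show thesis by (rule cramer[OF 2])
  next
    case 3
    have "(p$1 * q$3 - p$3 * q$1) * r$1 = (r$1 * q$3 - r$3 * q$1) * p$1 + (p$1 * r$3 - p$3 * r$1) * q$1"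
      "(p$1 * q$3 - p$3 * q$1) * r$2 = (r$1 * q$3 - r$3 * q$1) * p$2 + (p$1 * r$3 - p$3 * r$1) * q$2"
      "(p$1 * q$3 - p$3 * q$1) * r$3 = (r$1 * q$3 - r$3 * q$1) * p$3 + (p$1 * r$3 - p$3 * r$1) * q$3"
      using det by (simp_all add: algebra_simps)
    then show thesis by (rule cramer[OF 3])
  qed
qed

lemma ex_point_on_line:
  obtains Q where "on_line Q l" "Q \<noteq> P"
proof -
  obtain a where a: "a \<noteq> 0" "l = pt a" by (rule ex_pt)
  have "\<exists>u v. u \<noteq> 0 \<and> v \<noteq> 0 \<and> \<not> parallel u v \<and> on_line (pt u) l \<and> on_line (pt v) l"
  proof -
    consider "a$1 \<noteq> 0" | "a$2 \<noteq> 0" | "a$3 \<noteq> 0"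
      using a by (auto simp: vec3_eq_iff)
    then show ?thesis
    proof cases
      case 1
      then show ?thesis
        using a by (intro exI[of _ "vector [a$2, - a$1, 0]"] exI[of _ "vector [a$3, 0, - a$1]"])
          (auto simp: vec3_eq_iff parallel_def on_line_pt)
    next
      case 2
      then show ?thesis
        using a by (intro exI[of _ "vector [a$2, - a$1, 0]"] exI[of _ "vector [0, a$3, - a$2]"])
          (auto simp: vec3_eq_iff parallel_def on_line_pt)
    next
      case 3
      then show ?thesis
        using a by (intro exI[of _ "vector [0, a$3, - a$2]"] exI[of _ "vector [a$3, 0, - a$1]"])
          (auto simp: vec3_eq_iff parallel_def on_line_pt)
    qed
  qed
  then show thesis
    using that by (metis pt_eq_iff)
qed

lemma line_unique:
  assumes "P \<noteq> Q" "on_line P l" "on_line Q l" "on_line P m" "on_line Q m"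
  shows "l = m"
proof -
  obtain p q a b where *: "p \<noteq> 0" "q \<noteq> 0" "a \<noteq> 0" "b \<noteq> 0" "P = pt p" "Q = pt q" "l = pt a" "m = pt b"
    by (metis ex_pt)
  then show ?thesis
    using assms orthogonal_parallel[of p q a b] by (simp add: pt_eq_iff on_line_pt)
qed

text \<open>Restricted to \<open>p + t q\<close>, the cubic has the coefficients of lemma \<open>vanishing_order_pt\<close>, and these are
not all \<open>0\<close> because the curve contains no line. Passing to another point \<open>s p + t q\<close> of the line
multiplies the first coefficient that does not vanish by a power of \<open>t \<noteq> 0\<close>; so the order does
not depend on the auxiliary point.\<close>

lemma int_mult_pt:
  assumes "p \<noteq> 0" "q \<noteq> 0" "pt p \<noteq> pt q" "on_line (pt p) l" "on_line (pt q) l"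
  shows "int_mult l (pt p) = (if polar p p p \<noteq> 0 then 0 else if polar p p q \<noteq> 0 then 1
    else if polar p q q \<noteq> 0 then 2 else 3)" (is "_ = ?n")
proof -
  obtain a where a: "a \<noteq> 0" "l = pt a" by (rule ex_pt)
  have order: "vanishing_order (pt p) (pt q) = (if polar p p p \<noteq> 0 then 0
      else if polar p p q \<noteq> 0 then 1 else if polar p q q \<noteq> 0 then 2 else 3)"
    if "q \<noteq> 0" "pt p \<noteq> pt q" for q
  proof -
    have "polar p p p \<noteq> 0 \<or> 3 * polar p p q \<noteq> 0 \<or> 3 * polar p q q \<noteq> 0 \<or> polar q q q \<noteq> 0"
      using fermat_contains_no_line[of p q] that assms by (auto simp: pt_eq_iff)
    from order_0_cubic[OF this] show ?thesis
      using that assms by (simp add: vanishing_order_pt)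
  qed
  have "vanishing_order (pt p) Q = ?n" if Q: "on_line Q l" "Q \<noteq> pt p" for Q
  proof -
    obtain r where r: "r \<noteq> 0" "Q = pt r" by (rule ex_pt)
    then obtain s t where st: "r = s *s p + t *s q"
      using line_spanned[of p q a r] assms a Q by (auto simp: on_line_pt pt_eq_iff)
    have "t \<noteq> 0"
      using st r Q assms by (metis add.right_neutral pt_smult vector_smult_lzero)
    have "polar p p r = s * polar p p p + t * polar p p q"
      "polar p r r = s^2 * polar p p p + 2 * s * t * polar p p q + t^2 * polar p q q"
      unfolding st polar_def by (simp_all, algebra+)
    then show ?thesis
      using order[of r] r Q \<open>t \<noteq> 0\<close> by auto
  qed
  moreover have "vanishing_order (pt p) (pt q) = ?n"
    using order assms by blast
  ultimately have "(THE n. \<forall>Q. on_line Q l \<and> Q \<noteq> pt p \<longrightarrow> vanishing_order (pt p) Q = n) = ?n"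
    using assms by (intro the_equality) (blast, metis)
  then show ?thesis
    using assms by (simp add: int_mult_def)
qed

lemma on_line_tangent:
  assumes "p \<noteq> 0" "q \<noteq> 0"
  shows "on_line (pt q) (tangent (pt p)) \<longleftrightarrow> polar p p q = 0"
proof -
  have "(\<chi> i. 3 * (p$i)\<^sup>2) \<noteq> 0" using assms by (auto simp: vec_eq_iff)
  moreover have "tangent (pt p) = pt (\<chi> i. 3 * (p$i)\<^sup>2)"
    using assms pt_refl[of p] by (simp add: tangent.abs_eq)
  moreover have "3 * (p$1)\<^sup>2 * q$1 + 3 * (p$2)\<^sup>2 * q$2 + 3 * (p$3)\<^sup>2 * q$3 = 3 * polar p p q"
    by (simp add: polar_def power2_eq_square algebra_simps)
  ultimately show ?thesis
    using assms by (simp add: on_line_pt)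
qed

lemma int_mult_pos_iff: "int_mult l P > 0 \<longleftrightarrow> on_line P l \<and> P \<in> fermat"
proof (cases "on_line P l")
  case True
  obtain Q where Q: "on_line Q l" "Q \<noteq> P" by (rule ex_point_on_line)
  obtain p q where "p \<noteq> 0" "q \<noteq> 0" "P = pt p" "Q = pt q" by (metis ex_pt)
  then show ?thesis
    using True Q int_mult_pt[of p q l] by (simp add: fermat_pt)
qed (simp add: int_mult_def)

lemma tangent_of_int_mult:
  assumes "int_mult l P \<ge> 2"
  shows "l = tangent P"
proof -
  have P: "on_line P l" "P \<in> fermat" using assms int_mult_pos_iff[of l P] by auto
  obtain Q where Q: "on_line Q l" "Q \<noteq> P" by (rule ex_point_on_line)
  obtain p q where pq: "p \<noteq> 0" "q \<noteq> 0" "P = pt p" "Q = pt q" by (metis ex_pt)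
  then have "polar p p p = 0" "polar p p q = 0"
    using P Q assms int_mult_pt[of p q l] by (auto simp: fermat_pt split: if_splits)
  then show ?thesis
    using P Q pq line_unique[of P Q l "tangent P"] by (simp add: on_line_tangent)
qed

section \<open>The third point of intersection\<close>

lemma cut_by_line_commute:
  assumes "cut_by_line P Q R"
  shows "cut_by_line Q P R" "cut_by_line P R Q"
  using assms by (simp_all add: cut_by_line_def add_mset_commute)

lemma cut_by_line_on:
  assumes "\<forall>X. int_mult l X = count {#P, Q, R#} X" "X \<in> {P, Q, R}"
  shows "on_line X l" "X \<in> fermat"
proof -
  have "int_mult l X > 0" using assms by auto
  then show "on_line X l" "X \<in> fermat" by (simp_all add: int_mult_pos_iff)
qed

text \<open>A line that cuts out \<open>P\<close> and \<open>Q\<close> is determined by them: it joins them, or it is the tangent when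
they are equal. So the multiset of intersection points is the same for \<open>R\<close> and \<open>R'\<close>.\<close>

lemma cut_by_line_unique:
  assumes "cut_by_line P Q R" "cut_by_line P Q R'"
  shows "R = R'"
proof -
  obtain l l' where l: "\<forall>X. int_mult l X = count {#P, Q, R#} X"
    and l': "\<forall>X. int_mult l' X = count {#P, Q, R'#} X"
    using assms by (auto simp only: cut_by_line_def)
  have "l = l'"
  proof (cases "P = Q")
    case True
    have "int_mult l P \<ge> 2" "int_mult l' P \<ge> 2" using l l' True by auto
    then show ?thesis using tangent_of_int_mult by metis
  next
    case False
    then show ?thesis
      using line_unique[of P Q] cut_by_line_on[OF l] cut_by_line_on[OF l'] by blast
  qed
  then have "{#P, Q, R#} = {#P, Q, R'#}"
    using l l' by (intro multiset_eqI) metis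
  then show ?thesis by simp
qed

lemma third_eqI: "cut_by_line P Q R \<Longrightarrow> third P Q = R"
  unfolding third_def using cut_by_line_unique by blast

text \<open>For \<open>p\<close> and \<open>q\<close> on the curve, the cubic takes the value \<open>3 s t (s A + t B)\<close> at \<open>s p + t q\<close>,
where \<open>A = polar p p q\<close> and \<open>B = polar p q q\<close>. The third root is \<open>s = B\<close>, \<open>t = - A\<close>.\<close>

definition chord :: "complex^3 \<Rightarrow> complex^3 \<Rightarrow> complex^3" where
  "chord p q = polar p q q *s p - polar p p q *s q"

lemma chord_neq_0:
  assumes "p \<noteq> 0" "q \<noteq> 0" "\<not> parallel p q" "polar p p p = 0" "polar q q q = 0"
  shows "chord p q \<noteq> 0"
proof
  assume "chord p q = 0"
  then have *: "polar p q q * p$i = polar p p q * q$i" for i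
    by (simp add: chord_def vec_eq_iff)
  have "polar p q q \<noteq> 0 \<or> polar p p q \<noteq> 0"
    using assms fermat_contains_no_line by metis
  then have "polar p q q * (p$i * q$j - p$j * q$i) = 0" "polar p p q * (p$i * q$j - p$j * q$i) = 0" for i j
    using *[of i] *[of j] by algebra+
  then have "p$i * q$j = p$j * q$i" for i j
    using \<open>_ \<or> _\<close> by (metis eq_iff_diff_eq_0 mult_eq_0_iff)
  then show False
    using assms by (simp add: parallel_def)
qed

text \<open>The statement includes the tangential cases: \<open>A = 0\<close> means that the line is tangent at \<open>p\<close> and then
the third point is \<open>p\<close> again; likewise \<open>B = 0\<close> for \<open>q\<close>.\<close>

lemma cut_by_chord:
  assumes pq: "p \<noteq> 0" "q \<noteq> 0" "pt p \<noteq> pt q" "polar p p p = 0" "polar q q q = 0"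
  shows "cut_by_line (pt p) (pt q) (pt (chord p q))"
proof -
  define A B where "A = polar p p q" and "B = polar p q q"
  define r where "r = chord p q"
  have npar: "\<not> parallel p q" using pq by (simp add: pt_eq_iff)
  have AB: "A \<noteq> 0 \<or> B \<noteq> 0"
    using fermat_contains_no_line[OF npar] pq by (auto simp: A_def B_def)
  have r: "r \<noteq> 0" "r = B *s p - A *s q"
    using chord_neq_0[OF pq(1,2) npar pq(4,5)] by (simp_all add: r_def chord_def A_def B_def)
  define a where "a = cross p q"
  define l where "l = pt a"
  have "a \<noteq> 0" using npar by (simp add: a_def cross_eq_0_iff)
  have on: "on_line (pt p) l" "on_line (pt q) l"
    using \<open>a \<noteq> 0\<close> pq by (simp_all add: l_def on_line_pt, simp_all add: a_def cross_def algebra_simps)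
  have rp: "pt r = pt p \<longleftrightarrow> A = 0" and rq: "pt r = pt q \<longleftrightarrow> B = 0"
  proof -
    have "r$i * p$j - r$j * p$i = A * (p$i * q$j - p$j * q$i)"
      "r$i * q$j - r$j * q$i = B * (p$i * q$j - p$j * q$i)" for i j
      by (simp_all add: r(2) algebra_simps)
    then have "r$i * p$j = r$j * p$i \<longleftrightarrow> A = 0 \<or> p$i * q$j = p$j * q$i"
      "r$i * q$j = r$j * q$i \<longleftrightarrow> B = 0 \<or> p$i * q$j = p$j * q$i" for i j
      by (metis eq_iff_diff_eq_0 mult_eq_0_iff)+
    then show "pt r = pt p \<longleftrightarrow> A = 0" "pt r = pt q \<longleftrightarrow> B = 0"
      using pq(1,2) r(1) npar unfolding parallel_def by (simp_all add: pt_eq_iff parallel_def, blast+)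
  qed
  have on_r: "on_line (pt r) l"
    using \<open>a \<noteq> 0\<close> r by (simp add: l_def on_line_pt, simp add: a_def cross_def algebra_simps)
  have Fr: "polar r r r = 0"
    using pq polar_combine[of B p "- A" q]
    by (simp add: r(2) A_def[symmetric] B_def[symmetric] power2_eq_square)
  have int_p: "int_mult l (pt p) = (if A \<noteq> 0 then 1 else 2)"
    using int_mult_pt[of p q l] pq on AB by (auto simp: A_def B_def)
  have int_q: "int_mult l (pt q) = (if B \<noteq> 0 then 1 else 2)"
  proof -
    have "polar q q p = B" "polar q p p = A"
      by (simp_all add: A_def B_def polar_def mult_ac)
    then show ?thesis using int_mult_pt[of q p l] pq on AB by auto
  qed
  have "int_mult l X = count {#pt p, pt q, pt r#} X" for X
  proof (cases "on_line X l")
    case False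
    then show ?thesis
      using on on_r by (auto simp: int_mult_def)
  next
    case True
    obtain x where x: "x \<noteq> 0" "X = pt x" by (rule ex_pt)
    obtain s t where st: "x = s *s p + t *s q"
      using line_spanned[OF npar \<open>a \<noteq> 0\<close>, of x] on True x \<open>a \<noteq> 0\<close> pq
      by (auto simp: l_def on_line_pt)
    consider "t = 0" | "s = 0" | "s \<noteq> 0" "t \<noteq> 0" by blast
    then show ?thesis
    proof cases
      case 1
      then have "X = pt p" using x st pt_smult[of s p] pq by auto
      then show ?thesis using int_p rp pq by auto
    next
      case 2
      then have "X = pt q" using x st pt_smult[of t q] pq by auto
      then show ?thesis using int_q rq pq by auto
    next
      case 3
      have xp: "X \<noteq> pt p" and xq: "X \<noteq> pt q"
        using 3 x pq npar by (auto simp: pt_eq_iff st parallel_def algebra_simps)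
      have Fx: "polar x x x = 3 * s * t * (s * A + t * B)"
        using pq polar_combine[of s p t q]
        by (simp add: st A_def[symmetric] B_def[symmetric] power2_eq_square algebra_simps)
      show ?thesis
      proof (cases "s * A + t * B = 0")
        case True
        then have nz: "A \<noteq> 0" "B \<noteq> 0" using AB 3 by auto
        have "t * B = - (s * A)" using True by (simp add: eq_neg_iff_add_eq_0 add.commute)
        then have "B *s x = s *s r"
          by (simp add: st r(2) vec_eq_iff algebra_simps)
        then have "X = pt r"
          using x pt_smult[of B x] pt_smult[of s r] nz r 3 by metis
        have "polar x x p = t * (s * A + (s * A + t * B))"
          using pq(4) unfolding st A_def B_def polar_def by simp algebra
        then have "polar x x p \<noteq> 0" using True nz 3 by simp
        then have "int_mult l X = 1"
          using int_mult_pt[of x p l] x pq xp on \<open>on_line X l\<close> Fx True by simp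
        then show ?thesis
          using \<open>X = pt r\<close> xp xq by simp
      next
        case False
        then have "polar x x x \<noteq> 0" using 3 Fx by simp
        then have "X \<notin> fermat" using x by (simp add: fermat_pt)
        then have "int_mult l X = 0" using int_mult_pos_iff[of l X] by simp
        moreover have "X \<noteq> pt r" using \<open>X \<notin> fermat\<close> Fr r by (auto simp: fermat_pt)
        ultimately show ?thesis using xp xq by simp
      qed
    qed
  qed
  then show ?thesis
    by (auto simp only: cut_by_line_def r_def)
qed


text \<open>The residual point of the tangent line at \<open>p\<close>.\<close>

definition tangential :: "complex^3 \<Rightarrow> complex^3" where
  "tangential p = vector [p$1 * (p$2^3 - p$3^3), p$2 * (p$3^3 - p$1^3), p$3 * (p$1^3 - p$2^3)]"

lemma cubes_eq_imp_0:
  fixes p :: "complex^3"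
  assumes "polar p p p = 0" "p$2^3 = p$1^3" "p$3^3 = p$1^3"
  shows "p = 0"
proof -
  have "3 * p$1^3 = 0"
    using assms by (simp add: polar_def power3_eq_cube)
  then show ?thesis using assms(2,3) by (simp add: vec3_eq_iff)
qed

lemma tangential_neq_0:
  assumes "p \<noteq> 0" "polar p p p = 0"
  shows "tangential p \<noteq> 0"
proof
  assume "tangential p = 0"
  then have *: "p$1 = 0 \<or> p$2^3 = p$3^3" "p$2 = 0 \<or> p$3^3 = p$1^3" "p$3 = 0 \<or> p$1^3 = p$2^3"
    by (simp_all add: tangential_def vec3_eq_iff)
  have sum: "p$1^3 + p$2^3 + p$3^3 = 0"
    using assms(2) by (simp add: polar_def power3_eq_cube)
  have "p$1 = 0 \<and> p$2 = 0 \<and> p$3 = 0"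
  proof (cases "p$1 = 0 \<or> p$2 = 0 \<or> p$3 = 0")
    case True
    then show ?thesis using * sum by fastforce
  next
    case False
    then have "p$2^3 = p$1^3" "p$3^3 = p$1^3" using * by simp_all
    then have "p = 0" using cubes_eq_imp_0 assms(2) by blast
    then show ?thesis by simp
  qed
  then show False using assms(1) by (simp add: vec3_eq_iff)
qed

lemma polar_tangential:
  "polar p p (tangential p) = 0"
  "polar p p p = 0 \<Longrightarrow> polar (tangential p) (tangential p) (tangential p) = 0"
proof -
  show "polar p p (tangential p) = 0"
    by (simp add: polar_def tangential_def) algebra
  assume "polar p p p = 0"
  then show "polar (tangential p) (tangential p) (tangential p) = 0"
    unfolding polar_def tangential_def vector_3 by algebra
qed

text \<open>The flexes of the Fermat cubic are its points on the three coordinate lines.\<close>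

lemma flex_coordinate_eq_0:
  assumes "parallel (tangential p) p" "polar p p p = 0"
  shows "p$1 = 0 \<or> p$2 = 0 \<or> p$3 = 0"
proof -
  have "p$1 * p$2 * p$3^3 = 0"
    using assms unfolding parallel_def tangential_def polar_def vector_3 by algebra
  then show ?thesis by auto
qed

lemma flex_tangent_polar:
  assumes "p \<noteq> 0" "polar p p p = 0" "p$1 = 0 \<or> p$2 = 0 \<or> p$3 = 0" "polar p p q = 0"
  shows "polar p q q = 0"
proof -
  have *: "a^3 * (a * b^2 + c * d^2) = 0" if "a^3 + c^3 = 0" "a^2 * b + c^2 * d = 0" for a b c d :: complex
    using that by algebra
  have cubic: "p$1^3 + p$2^3 + p$3^3 = 0" "p$1^2 * q$1 + p$2^2 * q$2 + p$3^2 * q$3 = 0"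
    using assms(2,4) by (simp_all add: polar_def power3_eq_cube power2_eq_square)
  have B: "polar p q q = p$1 * q$1^2 + p$2 * q$2^2 + p$3 * q$3^2"
    by (simp add: polar_def power2_eq_square)
  consider "p$1 = 0" "p$2 \<noteq> 0" | "p$2 = 0" "p$3 \<noteq> 0" | "p$3 = 0" "p$1 \<noteq> 0"
    using assms(1,3) cubic(1) by (auto simp: vec3_eq_iff)
  then show ?thesis
  proof cases
    case 1
    then show ?thesis using *[of "p$2" "p$3" "q$2" "q$3"] cubic B by simp
  next
    case 2
    then show ?thesis using *[of "p$3" "p$1" "q$3" "q$1"] cubic B by (simp add: add.commute)
  next
    case 3
    then show ?thesis using *[of "p$1" "p$2" "q$1" "q$2"] cubic B by simp
  qed
qed

text \<open>If the tangential point \<open>d\<close> differs from \<open>p\<close>, then the chord through \<open>p\<close> and \<open>d\<close> is the tangent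
at \<open>p\<close>, and its third point is \<open>p\<close>. Otherwise \<open>p\<close> is a flex, and the tangent meets the curve in
\<open>p\<close> with multiplicity \<open>3\<close> and nowhere else.\<close>

lemma cut_by_tangent:
  assumes p: "p \<noteq> 0" "polar p p p = 0"
  shows "cut_by_line (pt p) (pt p) (pt (tangential p))"
proof (cases "pt (tangential p) = pt p")
  case False
  define d where "d = tangential p"
  have d: "d \<noteq> 0" "polar d d d = 0" "polar p p d = 0"
    using p tangential_neq_0 polar_tangential by (simp_all add: d_def)
  then have eq: "chord p d = polar p d d *s p" by (simp add: chord_def)
  have "chord p d \<noteq> 0"
    using p d False by (intro chord_neq_0) (simp_all add: d_def pt_eq_iff parallel_commute[of p])
  then have "pt (chord p d) = pt p"
    using eq p pt_smult by auto
  then have "cut_by_line (pt p) (pt d) (pt p)"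
    using cut_by_chord[of p d] p d False by (auto simp: d_def)
  then show ?thesis
    unfolding d_def by (rule cut_by_line_commute)
next
  case True
  define l where "l = tangent (pt p)"
  obtain Q where Q: "on_line Q l" "Q \<noteq> pt p" by (rule ex_point_on_line)
  obtain q where q: "q \<noteq> 0" "Q = pt q" by (rule ex_pt)
  have on: "on_line (pt p) l" using p by (simp add: l_def on_line_tangent)
  have A: "polar p p q = 0" using Q q p by (simp add: l_def on_line_tangent)
  have B: "polar p q q = 0"
    using flex_tangent_polar[OF p _ A] flex_coordinate_eq_0[of p] True p tangential_neq_0[OF p]
    by (simp add: pt_eq_iff)
  have "int_mult l X = count {#pt p, pt p, pt p#} X" for X
  proof (cases "X = pt p")
    case True
    then show ?thesis using int_mult_pt[of p q l] p q Q on A B by simp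
  next
    case False
    have "\<not> (on_line X l \<and> X \<in> fermat)"
    proof
      assume X: "on_line X l \<and> X \<in> fermat"
      obtain x where x: "x \<noteq> 0" "X = pt x" by (rule ex_pt)
      have "int_mult l (pt p) = 3" using int_mult_pt[of p q l] p q Q on A B by simp
      then have "polar p p x = 0 \<and> polar p x x = 0"
        using int_mult_pt[of p x l] p x X on False by (auto split: if_splits)
      then show False
        using fermat_contains_no_line[of p x] p x X False
        by (auto simp: fermat_pt pt_eq_iff parallel_commute[of p])
    qed
    then show ?thesis using int_mult_pos_iff[of l X] False by auto
  qed
  then show ?thesis unfolding True by (auto simp only: cut_by_line_def)
qed

lemma third_chord:
  assumes "p \<noteq> 0" "q \<noteq> 0" "pt p \<noteq> pt q" "polar p p p = 0" "polar q q q = 0"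
  shows "third (pt p) (pt q) = pt (chord p q)"
  using assms by (intro third_eqI cut_by_chord)

lemma third_tangential:
  assumes "p \<noteq> 0" "polar p p p = 0"
  shows "third (pt p) (pt p) = pt (tangential p)"
  using assms by (intro third_eqI cut_by_tangent)

lemma cut_by_line_third:
  assumes "P \<in> fermat" "Q \<in> fermat"
  shows "cut_by_line P Q (third P Q)"
proof -
  obtain p q where "p \<noteq> 0" "q \<noteq> 0" "P = pt p" "Q = pt q" by (metis ex_pt)
  then have "\<exists>R. cut_by_line P Q R"
    using assms cut_by_chord[of p q] cut_by_tangent[of p] by (cases "P = Q") (auto simp: fermat_pt)
  then show ?thesis using third_eqI by metis
qed

lemma third_in_fermat: "P \<in> fermat \<Longrightarrow> Q \<in> fermat \<Longrightarrow> third P Q \<in> fermat"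
  using cut_by_line_third[of P Q] cut_by_line_on(2) unfolding cut_by_line_def by blast

lemma third_commute: "P \<in> fermat \<Longrightarrow> Q \<in> fermat \<Longrightarrow> third P Q = third Q P"
  using cut_by_line_third cut_by_line_commute(1) third_eqI by metis

lemma third_third: "P \<in> fermat \<Longrightarrow> Q \<in> fermat \<Longrightarrow> third P (third P Q) = Q"
  using cut_by_line_third cut_by_line_commute(2) third_eqI by metis


section \<open>Translation by a 3-torsion point\<close>

definition rot_vec :: "complex^3 \<Rightarrow> complex^3" where
  "rot_vec v = vector [v$2, v$3, v$1]"

lemma rot_vec_component [simp]: "rot_vec v $ 1 = v$2" "rot_vec v $ 2 = v$3" "rot_vec v $ 3 = v$1"
  by (simp_all add: rot_vec_def)

lemma rot_vec_eq_0_iff [simp]: "rot_vec v = 0 \<longleftrightarrow> v = 0"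
  by (auto simp: vec3_eq_iff)

lemma polar_rot_vec [simp]: "polar (rot_vec u) (rot_vec v) (rot_vec w) = polar u v w"
  by (simp add: polar_def)

definition swap_vec :: "complex^3 \<Rightarrow> complex^3" where
  "swap_vec v = vector [v$2, v$1, v$3]"

lemma swap_vec_component [simp]: "swap_vec v $ 1 = v$2" "swap_vec v $ 2 = v$1" "swap_vec v $ 3 = v$3"
  by (simp_all add: swap_vec_def)

lemma swap_vec_eq_0_iff [simp]: "swap_vec v = 0 \<longleftrightarrow> v = 0"
  by (auto simp: vec3_eq_iff)

lemma polar_swap_vec [simp]: "polar (swap_vec u) (swap_vec v) (swap_vec w) = polar u v w"
  by (simp add: polar_def)

lift_definition rot :: "cp2 \<Rightarrow> cp2" is rot_vec
  by (auto simp: vec3_eq_iff)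

lift_definition swap :: "cp2 \<Rightarrow> cp2" is swap_vec
  by (auto simp: vec3_eq_iff)

lemma rot_pt: "v \<noteq> 0 \<Longrightarrow> rot (pt v) = pt (rot_vec v)"
  using pt_refl[of v] by (simp add: rot.abs_eq)

lemma swap_pt: "v \<noteq> 0 \<Longrightarrow> swap (pt v) = pt (swap_vec v)"
  using pt_refl[of v] by (simp add: swap.abs_eq)

lemma rot_rot_rot [simp]: "rot (rot (rot P)) = P"
proof -
  obtain p where "p \<noteq> 0" "P = pt p" by (rule ex_pt)
  moreover have "rot_vec (rot_vec (rot_vec p)) = p" by (simp add: vec3_eq_iff)
  ultimately show ?thesis by (simp add: rot_pt)
qed

lemma swap_rot: "swap (rot P) = rot (rot (swap P))"
proof -
  obtain p where "p \<noteq> 0" "P = pt p" by (rule ex_pt)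
  moreover have "swap_vec (rot_vec p) = rot_vec (rot_vec (swap_vec p))" by (simp add: vec3_eq_iff)
  ultimately show ?thesis by (simp add: rot_pt swap_pt)
qed

lemma rot_in_fermat [simp]: "rot P \<in> fermat \<longleftrightarrow> P \<in> fermat"
  by (rule ex_pt[of P]) (simp add: rot_pt fermat_pt)

lemma swap_in_fermat [simp]: "swap P \<in> fermat \<longleftrightarrow> P \<in> fermat"
  by (rule ex_pt[of P]) (simp add: swap_pt fermat_pt)

text \<open>A point fixed by the permutation has coordinates with equal cubes, whose sum is not \<open>0\<close>.\<close>

lemma rot_neq:
  assumes "P \<in> fermat"
  shows "rot P \<noteq> P"
proof
  assume fixed: "rot P = P"
  obtain p where p: "p \<noteq> 0" "P = pt p" by (rule ex_pt)
  then have F: "polar p p p = 0" and par: "parallel (rot_vec p) p"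
    using assms fixed by (simp_all add: fermat_pt rot_pt pt_eq_iff)
  have "p$2^3 = p$1^3" "p$3^3 = p$1^3"
    using par unfolding parallel_def rot_vec_component by algebra+
  then show False using cubes_eq_imp_0[OF F] p by simp
qed

lemmas vector_components = vector_minus_component vector_smult_component vector_3
  rot_vec_component swap_vec_component

lemma chord_rot_vec:
  assumes "polar p p p = 0" "polar q q q = 0"
  shows "parallel (chord (rot_vec p) q) (rot_vec (rot_vec (chord p q)))"
  using assms unfolding parallel_def chord_def polar_def vector_components
  by (intro conjI; algebra)

lemma chord_rot_vec_self: "parallel (chord (rot_vec p) p) (rot_vec (rot_vec (tangential p)))"
  unfolding parallel_def chord_def polar_def tangential_def vector_components
  by (intro conjI; algebra)

lemma tangential_rot_vec: "parallel (tangential (rot_vec p)) (rot_vec (rot_vec (chord p (rot_vec p))))"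
  unfolding parallel_def chord_def polar_def tangential_def vector_components
  by (intro conjI; algebra)

text \<open>This is how a translation \<open>P \<mapsto> P + t\<close> with \<open>3 t = 0\<close> behaves: \<open>- (P + t) - Q\<close> is
\<open>- P - Q - t\<close>, and \<open>- t = 2 t\<close>. The cases separate the formulas that compute the two sides; the
preceding lemmas compare them.\<close>

lemma third_rot:
  assumes "P \<in> fermat" "Q \<in> fermat"
  shows "third (rot P) Q = rot (rot (third P Q))"
proof -
  obtain p q where pq: "p \<noteq> 0" "q \<noteq> 0" "P = pt p" "Q = pt q" by (metis ex_pt)
  have F: "polar p p p = 0" "polar q q q = 0"
    using assms pq by (simp_all add: fermat_pt)
  have rot: "rot P = pt (rot_vec p)" using pq by (simp add: rot_pt)
  have neq: "rot P \<noteq> P" using assms rot_neq by simp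
  have chord_neq_0: "chord u v \<noteq> 0"
    if "u \<noteq> 0" "v \<noteq> 0" "pt u \<noteq> pt v" "polar u u u = 0" "polar v v v = 0" for u v
    using that chord_neq_0[of u v] by (simp add: pt_eq_iff)
  consider "P = Q" | "rot P = Q" | "P \<noteq> Q" "rot P \<noteq> Q" by blast
  then show ?thesis
  proof cases
    case 1
    then have "third (rot P) Q = pt (chord (rot_vec p) p)" "third P Q = pt (tangential p)"
      using pq F neq rot third_chord[of "rot_vec p" p] third_tangential[of p] by simp_all
    then show ?thesis
      using pq F neq rot chord_neq_0[of "rot_vec p" p] tangential_neq_0[of p] chord_rot_vec_self[of p]
      by (simp add: rot_pt pt_eq_iff)
  next
    case 2
    then have "third (rot P) Q = pt (tangential (rot_vec p))" "third P Q = pt (chord p (rot_vec p))"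
      using pq F neq rot third_chord[of p "rot_vec p"] third_tangential[of "rot_vec p"] by auto
    then show ?thesis
      using pq F neq rot chord_neq_0[of p "rot_vec p"] tangential_neq_0[of "rot_vec p"]
        tangential_rot_vec[of p] parallel_commute[of p "rot_vec p"]
      by (simp add: rot_pt pt_eq_iff)
  next
    case 3
    then have "third (rot P) Q = pt (chord (rot_vec p) q)" "third P Q = pt (chord p q)"
      using pq F rot third_chord[of "rot_vec p" q] third_chord[of p q] by simp_all
    then show ?thesis
      using 3 pq F rot chord_neq_0[of "rot_vec p" q] chord_neq_0[of p q] chord_rot_vec[of p q]
      by (simp add: rot_pt pt_eq_iff)
  qed
qed

section \<open>Sylvester's formula and associativity\<close>

text \<open>Another formula for the third point. It agrees with the chord wherever it does not vanish. For points
of the curve it vanishes exactly when \<open>p\<close> arises from \<open>q\<close>, up to scaling, by multiplying the coordinates with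
\<open>1\<close>, \<open>\<omega>\<close>, \<open>\<omega>\<^sup>2\<close> for some cube root of unity \<open>\<omega>\<close>; in particular for \<open>p = q\<close>.\<close>

definition sylvester :: "complex^3 \<Rightarrow> complex^3 \<Rightarrow> complex^3" where
  "sylvester p q = vector [p$1^2 * q$2 * q$3 - q$1^2 * p$2 * p$3,
    p$2^2 * q$3 * q$1 - q$2^2 * p$3 * p$1, p$3^2 * q$1 * q$2 - q$3^2 * p$1 * p$2]"

lemma chord_sylvester:
  assumes "polar p p p = 0" "polar q q q = 0"
  shows "parallel (chord p q) (sylvester p q)"
  using assms unfolding parallel_def chord_def polar_def sylvester_def vector_components
  by (intro conjI; algebra)

text \<open>The associative law for the origin \<open>(1 : -1 : 0)\<close>, for which negation is \<^term>\<open>swap_vec\<close>, as an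
identity modulo the three equations that put \<open>p\<close>, \<open>q\<close>, \<open>x\<close> on the curve. Where one of the
vectors is \<open>0\<close> it carries no information.\<close>

lemma sylvester_assoc:
  assumes "polar p p p = 0" "polar q q q = 0" "polar x x x = 0"
  shows "parallel (sylvester (swap_vec (sylvester p q)) x) (sylvester p (swap_vec (sylvester q x)))"
  using assms unfolding parallel_def polar_def sylvester_def vector_components
  by (intro conjI; algebra)

lemma sylvester_scale: "sylvester (c *s p) (d *s q) = (c^2 * d^2) *s sylvester p q"
  by (simp add: vec3_eq_iff sylvester_def power2_eq_square algebra_simps)

lemma third_sylvester:
  assumes "p \<noteq> 0" "q \<noteq> 0" "polar p p p = 0" "polar q q q = 0" "sylvester p q \<noteq> 0"
  shows "third (pt p) (pt q) = pt (sylvester p q)"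
proof -
  have "pt p \<noteq> pt q"
  proof
    assume "pt p = pt q"
    then obtain c where "p = c *s q" using assms by (auto simp: pt_eq_iff_smult)
    then have "sylvester p q = c^2 *s sylvester q q"
      using sylvester_scale[of c q 1 q] by simp
    moreover have "sylvester q q = 0" by (simp add: sylvester_def vec3_eq_iff)
    ultimately show False using assms by simp
  qed
  then show ?thesis
    using assms third_chord[of p q] chord_sylvester[of p q] chord_neq_0[of p q]
    by (simp add: pt_eq_iff)
qed

lift_definition degenerate :: "cp2 \<Rightarrow> cp2 \<Rightarrow> bool" is "\<lambda>p q. sylvester p q = 0"
proof -
  fix p p' q q' :: "complex^3"
  assume "p \<noteq> 0 \<and> p' \<noteq> 0 \<and> (\<exists>c. p = c *s p')" "q \<noteq> 0 \<and> q' \<noteq> 0 \<and> (\<exists>c. q = c *s q')"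
  then obtain c d where "p = c *s p'" "q = d *s q'" "c \<noteq> 0" "d \<noteq> 0" by auto
  then show "(sylvester p q = 0) = (sylvester p' q' = 0)"
    by (simp add: sylvester_scale)
qed

lemma degenerate_pt: "p \<noteq> 0 \<Longrightarrow> q \<noteq> 0 \<Longrightarrow> degenerate (pt p) (pt q) \<longleftrightarrow> sylvester p q = 0"
  using pt_refl[of p] pt_refl[of q] by (simp add: degenerate.abs_eq)

lemma degenerate_rot_rot [simp]: "degenerate (rot P) (rot Q) \<longleftrightarrow> degenerate P Q"
proof -
  obtain p q where pq: "p \<noteq> 0" "q \<noteq> 0" "P = pt p" "Q = pt q" by (metis ex_pt)
  have "sylvester (rot_vec p) (rot_vec q) = rot_vec (sylvester p q)"
    by (simp add: sylvester_def vec3_eq_iff)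
  then show ?thesis using pq by (simp add: degenerate_pt rot_pt)
qed

text \<open>The translation \<^const>\<open>rot\<close> lies outside the subgroup of order \<open>3\<close> for which Sylvester's formula
vanishes. In coordinates: if both formulas vanish, then no coordinate of \<open>p\<close> or \<open>q\<close> is \<open>0\<close> and
comparing the equations gives \<open>q\<close> three equal cubes, whose sum is not \<open>0\<close>.\<close>

lemma not_degenerate_rot:
  assumes "P \<in> fermat" "Q \<in> fermat" "degenerate P Q"
  shows "\<not> degenerate (rot P) Q"
proof
  assume "degenerate (rot P) Q"
  obtain p q where pq: "p \<noteq> 0" "q \<noteq> 0" "P = pt p" "Q = pt q" by (metis ex_pt)
  then have F: "polar p p p = 0" "polar q q q = 0"
    using assms by (simp_all add: fermat_pt)
  have "sylvester p q = 0" "sylvester (rot_vec p) q = 0"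
    using pq assms(3) \<open>degenerate (rot P) Q\<close> by (simp_all add: rot_pt degenerate_pt)
  then have e: "p$1^2 * q$2 * q$3 = q$1^2 * p$2 * p$3" "p$2^2 * q$3 * q$1 = q$2^2 * p$3 * p$1"
      "p$3^2 * q$1 * q$2 = q$3^2 * p$1 * p$2"
    and f: "p$2^2 * q$2 * q$3 = q$1^2 * p$3 * p$1" "p$3^2 * q$3 * q$1 = q$2^2 * p$1 * p$2"
      "p$1^2 * q$1 * q$2 = q$3^2 * p$2 * p$3"
    by (simp_all add: sylvester_def vec3_eq_iff)
  have cubes: "p$1^3 + p$2^3 + p$3^3 = 0" "q$1^3 + q$2^3 + q$3^3 = 0"
    using F by (simp_all add: polar_def power3_eq_cube)
  have two: False if "p$i = 0" "p$j = 0" "(i, j) \<in> {(1, 2), (2, 3), (3, 1)}" for i j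
    using that cubes(1) pq(1) by (auto simp: vec3_eq_iff)
  have q: "q$1 \<noteq> 0" "q$2 \<noteq> 0" "q$3 \<noteq> 0"
  proof -
    have other: "q$2 \<noteq> 0 \<and> q$3 \<noteq> 0" if "q$1 = 0"
      using that cubes(2) pq(2) by (auto simp: vec3_eq_iff)
    show "q$1 \<noteq> 0" using other e(1) f(1) two[of 1 2] by auto
    have other: "q$3 \<noteq> 0 \<and> q$1 \<noteq> 0" if "q$2 = 0"
      using that cubes(2) pq(2) by (auto simp: vec3_eq_iff)
    show "q$2 \<noteq> 0" using other e(2) f(2) two[of 2 3] by auto
    have other: "q$1 \<noteq> 0 \<and> q$2 \<noteq> 0" if "q$3 = 0"
      using that cubes(2) pq(2) by (auto simp: vec3_eq_iff)
    show "q$3 \<noteq> 0" using other e(3) f(3) two[of 3 1] by auto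
  qed
  have p: "p$1 \<noteq> 0" "p$2 \<noteq> 0" "p$3 \<noteq> 0"
    using e q two[of 1 2] two[of 2 3] two[of 3 1] by auto
  have "(q$3^3 - q$1^3) * (p$2 * p$3) = 0" "(q$2^3 - q$1^3) * (p$3 * p$1) = 0"
    using e f by algebra+
  then have "q$2^3 = q$1^3" "q$3^3 = q$1^3" using p by simp_all
  then show False using cubes_eq_imp_0[OF F(2)] pq(2) by simp
qed

lemma rot_funpow_in_fermat [simp]: "(rot ^^ n) P \<in> fermat \<longleftrightarrow> P \<in> fermat"
  by (induction n) simp_all

lemma degenerate_rot_funpow [simp]: "degenerate ((rot ^^ n) P) ((rot ^^ n) Q) \<longleftrightarrow> degenerate P Q"
  by (induction n) simp_all

text \<open>Each of the two conditions excludes at most one of the three powers of \<^const>\<open>rot\<close>.\<close>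

lemma ex_rot_not_degenerate:
  assumes "P \<in> fermat" "Q \<in> fermat" "P' \<in> fermat" "Q' \<in> fermat"
  obtains n where "\<not> degenerate ((rot ^^ n) P) Q" "\<not> degenerate P' ((rot ^^ n) Q')"
proof -
  have rot_right: "degenerate P' (rot Q') \<longleftrightarrow> degenerate (rot (rot P')) Q'"
    "degenerate P' (rot (rot Q')) \<longleftrightarrow> degenerate (rot P') Q'"
    by (metis degenerate_rot_rot rot_rot_rot)+
  have left: "\<not> (degenerate X Y \<and> degenerate (rot X) Y)"
      "\<not> (degenerate (rot X) Y \<and> degenerate (rot (rot X)) Y)"
      "\<not> (degenerate (rot (rot X)) Y \<and> degenerate X Y)" if "X \<in> fermat" "Y \<in> fermat" for X Y
    using that not_degenerate_rot[of X Y] not_degenerate_rot[of "rot X" Y]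
      not_degenerate_rot[of "rot (rot X)" Y] by auto
  have "\<exists>n\<in>{0, 1, 2}. \<not> degenerate ((rot ^^ n) P) Q \<and> \<not> degenerate P' ((rot ^^ n) Q')"
    using left[OF assms(1,2)] left[OF assms(3,4)]
    by (auto simp: numeral_2_eq_2 rot_right)
  then show thesis using that by blast
qed

text \<open>The associative law \<open>(P + Q) + X = P + (Q + X)\<close> for the origin \<open>(1 : -1 : 0)\<close>, up to a final
negation of both sides: there \<open>P + Q = swap (third P Q)\<close>.\<close>

definition associates :: "cp2 \<Rightarrow> cp2 \<Rightarrow> cp2 \<Rightarrow> bool" where
  "associates P Q X \<longleftrightarrow> third (swap (third P Q)) X = third P (swap (third Q X))"

lemma rot_inj: "rot P = rot Q \<longleftrightarrow> P = Q"
  by (metis rot_rot_rot)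

lemma third_rot_right:
  "P \<in> fermat \<Longrightarrow> Q \<in> fermat \<Longrightarrow> third P (rot Q) = rot (rot (third P Q))"
  using third_rot[of Q P] third_commute[of P] by simp

lemma associates_rot:
  assumes "P \<in> fermat" "Q \<in> fermat" "X \<in> fermat"
  shows "associates (rot P) Q X \<longleftrightarrow> associates P Q X"
    "associates P (rot Q) X \<longleftrightarrow> associates P Q X"
    "associates P Q (rot X) \<longleftrightarrow> associates P Q X"
  using assms
  by (simp_all add: associates_def third_rot third_rot_right swap_rot third_in_fermat rot_inj)

lemma associates_rot_funpow:
  assumes "P \<in> fermat" "Q \<in> fermat" "X \<in> fermat"
  shows "associates ((rot ^^ i) P) ((rot ^^ j) Q) ((rot ^^ k) X) \<longleftrightarrow> associates P Q X"
proof -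
  have "associates ((rot ^^ i) P) Q X \<longleftrightarrow> associates P Q X" if "Q \<in> fermat" "X \<in> fermat" for Q X
    using assms that by (induction i) (simp_all add: associates_rot)
  moreover have "associates P ((rot ^^ j) Q) X \<longleftrightarrow> associates P Q X" if "X \<in> fermat" for X
    using assms that by (induction j) (simp_all add: associates_rot)
  moreover have "associates P Q ((rot ^^ k) X) \<longleftrightarrow> associates P Q X"
    using assms by (induction k) (simp_all add: associates_rot)
  ultimately show ?thesis using assms by simp
qed

lemma associates_if_not_degenerate:
  assumes "P \<in> fermat" "Q \<in> fermat" "X \<in> fermat"
    and "\<not> degenerate P Q" "\<not> degenerate Q X"
    and "\<not> degenerate (swap (third P Q)) X" "\<not> degenerate P (swap (third Q X))"
  shows "associates P Q X"
proof -
  obtain p q x where v: "p \<noteq> 0" "q \<noteq> 0" "x \<noteq> 0" "P = pt p" "Q = pt q" "X = pt x" by (metis ex_pt)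
  define r s where "r = swap_vec (sylvester p q)" and "s = swap_vec (sylvester q x)"
  have F: "polar p p p = 0" "polar q q q = 0" "polar x x x = 0"
    using assms v by (simp_all add: fermat_pt)
  have "sylvester p q \<noteq> 0" "sylvester q x \<noteq> 0"
    using assms v by (simp_all add: degenerate_pt)
  then have rs: "r \<noteq> 0" "s \<noteq> 0" "swap (third P Q) = pt r" "swap (third Q X) = pt s"
    using v F by (simp_all add: r_def s_def third_sylvester swap_pt)
  have "pt r \<in> fermat" "pt s \<in> fermat"
    using rs(3,4)[symmetric] assms by (simp_all add: third_in_fermat)
  then have "polar r r r = 0" "polar s s s = 0" using rs by (simp_all add: fermat_pt)
  moreover have "sylvester r x \<noteq> 0" "sylvester p s \<noteq> 0"
    using assms v rs by (simp_all add: degenerate_pt)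
  moreover have "parallel (sylvester r x) (sylvester p s)"
    unfolding r_def s_def using F by (rule sylvester_assoc)
  ultimately show ?thesis
    using v F rs by (simp add: associates_def third_sylvester pt_eq_iff)
qed

text \<open>Translate \<open>P\<close> and \<open>X\<close> so that neither is degenerate with \<open>Q\<close>. Then translate all three points by
the same power of \<^const>\<open>rot\<close>: this keeps the first two conditions, while the sums \<open>S = P + Q\<close> and
\<open>V = Q + X\<close> move twice as far as \<open>X\<close> and \<open>P\<close>. So the remaining two conditions depend on the power
chosen, and each excludes only one choice.\<close>

lemma associates:
  assumes "P \<in> fermat" "Q \<in> fermat" "X \<in> fermat"
  shows "associates P Q X"
proof -
  obtain i where i: "\<not> degenerate ((rot ^^ i) P) Q"
    using ex_rot_not_degenerate assms by metis
  obtain j where j: "\<not> degenerate Q ((rot ^^ j) X)"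
    using ex_rot_not_degenerate assms by metis
  define P1 X1 where "P1 = (rot ^^ i) P" and "X1 = (rot ^^ j) X"
  have fermat: "P1 \<in> fermat" "X1 \<in> fermat"
    using assms by (simp_all add: P1_def X1_def)
  define S V where "S = swap (third P1 Q)" and "V = swap (third Q X1)"
  have SV: "S \<in> fermat" "V \<in> fermat"
    using assms fermat by (simp_all add: S_def V_def third_in_fermat)
  obtain n where n: "\<not> degenerate ((rot ^^ n) S) X1" "\<not> degenerate P1 ((rot ^^ n) V)"
    using ex_rot_not_degenerate SV fermat by metis
  have third_funpow: "swap (third ((rot ^^ n) Y) ((rot ^^ n) Z)) = (rot ^^ n) ((rot ^^ n) (swap (third Y Z)))"
    if "Y \<in> fermat" "Z \<in> fermat" for Y Z
  proof (induction n)
    case (Suc n)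
    have "swap (third ((rot ^^ Suc n) Y) ((rot ^^ Suc n) Z))
        = rot (rot (swap (third ((rot ^^ n) Y) ((rot ^^ n) Z))))"
      using that by (simp add: third_rot third_rot_right third_in_fermat swap_rot)
    also have "\<dots> = (rot ^^ Suc n) ((rot ^^ Suc n) (swap (third Y Z)))"
      by (simp add: Suc funpow_swap1)
    finally show ?case .
  qed simp
  have "associates ((rot ^^ n) P1) ((rot ^^ n) Q) ((rot ^^ n) X1)"
    by (rule associates_if_not_degenerate)
      (use i j n assms fermat third_funpow in
        \<open>simp_all add: P1_def[symmetric] X1_def[symmetric] S_def[symmetric] V_def[symmetric]\<close>)
  then show ?thesis
    using assms fermat associates_rot_funpow[of P Q X i 0 j]
    by (simp add: associates_rot_funpow P1_def X1_def)
qed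

section \<open>The group law\<close>

text \<open>The point is the flex \<open>(1 : -1 : 0)\<close>.\<close>

lemma ex_flex_third_eq_swap: obtains Z where "Z \<in> fermat" "\<And>Q. Q \<in> fermat \<Longrightarrow> third Z Q = swap Q"
proof -
  define e :: "complex^3" where "e = vector [1, -1, 0]"
  have e: "e \<noteq> 0" "polar e e e = 0" by (simp_all add: e_def vec3_eq_iff polar_def)
  have "third (pt e) Q = swap Q" if "Q \<in> fermat" for Q
  proof -
    obtain q where q: "q \<noteq> 0" "Q = pt q" by (rule ex_pt)
    have F: "polar q q q = 0" using that q by (simp add: fermat_pt)
    show ?thesis
    proof (cases "pt e = Q")
      case True
      have "parallel (tangential e) (swap_vec e)"
        by (simp add: parallel_def tangential_def e_def)
      then show ?thesis
        using True[symmetric] e tangential_neq_0[of e] by (simp add: third_tangential swap_pt pt_eq_iff)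
    next
      case False
      have "parallel (chord e q) (swap_vec q)"
        unfolding parallel_def chord_def polar_def vector_components e_def by (intro conjI; algebra)
      then show ?thesis
        using False e q F chord_neq_0[of e q] by (simp add: third_chord swap_pt pt_eq_iff)
    qed
  qed
  then show thesis using that[of "pt e"] e by (simp add: fermat_pt)
qed

lemma fermat_group_simps:
  "carrier (fermat_group E) = fermat" "P \<otimes>\<^bsub>fermat_group E\<^esub> Q = third E (third P Q)"
  "\<one>\<^bsub>fermat_group E\<^esub> = E"
  by (simp_all add: fermat_group_def)

lemma third_third_right: "P \<in> fermat \<Longrightarrow> Q \<in> fermat \<Longrightarrow> third P (third Q P) = Q"
  using third_third[of P Q] third_commute[of P Q] by simp

text \<open>Everything but associativity follows from the symmetry of \<open>{P, Q, third P Q}\<close>. The negative of \<open>P\<close>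
is its third point with \<open>third E E\<close>, for any origin \<open>E\<close> on the curve.\<close>

lemma comm_group_fermat_groupI:
  assumes E: "E \<in> fermat"
    and assoc: "\<And>P Q X. P \<in> fermat \<Longrightarrow> Q \<in> fermat \<Longrightarrow> X \<in> fermat \<Longrightarrow>
      third (third E (third P Q)) X = third P (third E (third Q X))"
  shows "comm_group (fermat_group E)"
proof (rule comm_groupI, unfold fermat_group_simps)
  fix P assume P: "P \<in> fermat"
  let ?N = "third (third E E) P"
  have "third ?N P = third E E"
    using E P third_third[of P "third E E"] third_commute third_in_fermat by metis
  then show "\<exists>N\<in>fermat. third E (third N P) = E"
    using E P by (intro bexI[of _ ?N]) (simp_all add: third_third third_in_fermat)
qed (use E assoc in \<open>simp_all add: third_in_fermat third_commute third_third third_third_right\<close>)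

text \<open>In the group \<open>G\<close> of the special origin, the third point of \<open>A\<close> and \<open>B\<close> is \<open>k - A - B\<close> for a
constant \<open>k\<close>. So \<open>third E (third A B)\<close> is \<open>A + B - E\<close>, and both sides of the claim are
\<open>k - (P + Q + X - E)\<close>.\<close>

lemma third_assoc:
  assumes "E \<in> fermat" "P \<in> fermat" "Q \<in> fermat" "X \<in> fermat"
  shows "third (third E (third P Q)) X = third P (third E (third Q X))"
proof -
  obtain Z where Z: "Z \<in> fermat" "\<And>Q. Q \<in> fermat \<Longrightarrow> third Z Q = swap Q"
    using ex_flex_third_eq_swap by blast
  define G where "G = fermat_group Z"
  interpret comm_group G
    unfolding G_def using Z associates
    by (intro comm_group_fermat_groupI) (simp_all add: third_in_fermat associates_def)
  have carrier: "carrier G = fermat" by (simp add: G_def fermat_group_simps)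
  have mult: "A \<otimes>\<^bsub>G\<^esub> B = third Z (third A B)" for A B
    by (simp add: G_def fermat_group_simps)
  define k where "k = third Z Z"
  have k: "k \<in> carrier G" using Z by (simp add: k_def carrier third_in_fermat)
  have third: "third A B = k \<otimes>\<^bsub>G\<^esub> inv\<^bsub>G\<^esub> (A \<otimes>\<^bsub>G\<^esub> B)" if "A \<in> fermat" "B \<in> fermat" for A B
  proof -
    define C where "C = A \<otimes>\<^bsub>G\<^esub> B"
    have C: "C \<in> fermat" "third A B = third Z C"
      using that Z(1) by (simp_all add: C_def mult third_in_fermat third_third)
    have "third Z C \<otimes>\<^bsub>G\<^esub> C = third Z (third C (third C Z))"
      using C Z(1) by (simp add: mult third_commute third_in_fermat)
    also have "\<dots> = k" using C Z(1) by (simp add: third_third k_def)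
    finally have "k \<otimes>\<^bsub>G\<^esub> inv\<^bsub>G\<^esub> C = third Z C"
      using C Z(1) by (metis carrier inv_solve_right' third_in_fermat k)
    then show ?thesis using C by (simp add: C_def)
  qed
  have "third E (third A B) = A \<otimes>\<^bsub>G\<^esub> B \<otimes>\<^bsub>G\<^esub> inv\<^bsub>G\<^esub> E"
    if "A \<in> fermat" "B \<in> fermat" for A B
  proof -
    have G: "A \<in> carrier G" "B \<in> carrier G" "E \<in> carrier G"
      using that assms(1) by (simp_all add: carrier)
    have "k \<otimes>\<^bsub>G\<^esub> inv\<^bsub>G\<^esub> (E \<otimes>\<^bsub>G\<^esub> (k \<otimes>\<^bsub>G\<^esub> inv\<^bsub>G\<^esub> (A \<otimes>\<^bsub>G\<^esub> B)))
        = k \<otimes>\<^bsub>G\<^esub> (inv\<^bsub>G\<^esub> k \<otimes>\<^bsub>G\<^esub> (A \<otimes>\<^bsub>G\<^esub> B \<otimes>\<^bsub>G\<^esub> inv\<^bsub>G\<^esub> E))"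
      using G k by (simp add: inv_mult m_ac)
    also have "\<dots> = A \<otimes>\<^bsub>G\<^esub> B \<otimes>\<^bsub>G\<^esub> inv\<^bsub>G\<^esub> E"
      using G k by (simp add: m_assoc[symmetric])
    finally show ?thesis
      using that assms(1) third[of E "third A B"] third[of A B] third_in_fermat[of A B] by simp
  qed
  then show ?thesis
    using assms by (simp add: third third_in_fermat m_ac carrier[symmetric])
qed

lemma comm_group_fermat_group: "E \<in> fermat \<Longrightarrow> comm_group (fermat_group E)"
  using third_assoc by (intro comm_group_fermat_groupI)

text \<open>A line that meets the curve in \<open>E\<close> with multiplicity \<open>3\<close> is the tangent, which cuts out \<open>E\<close>, \<open>E\<close>
and \<open>third E E\<close>.\<close>

lemma third_flex:
  assumes "flex E"
  shows "third E E = E"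
proof -
  have E: "E \<in> fermat" using assms by (simp add: flex_def)
  obtain l where l: "int_mult l E \<ge> 3" using assms by (auto simp: flex_def)
  obtain m where m: "\<forall>X. int_mult m X = count {#E, E, third E E#} X"
    using cut_by_line_third[OF E E] by (auto simp only: cut_by_line_def)
  have "int_mult m E \<ge> 2" using m by simp
  then have "l = m" using l tangent_of_int_mult[of l E] tangent_of_int_mult[of m E] by simp
  then show ?thesis using l m by (simp split: if_splits)
qed

lemma residual_eq_third:
  assumes "P \<in> fermat" "third P P \<noteq> P"
  shows "residual P = third P P"
proof -
  obtain l where l: "\<forall>X. int_mult l X = count {#P, P, third P P#} X"
    using cut_by_line_third[OF assms(1,1)] by (auto simp only: cut_by_line_def)
  have "int_mult l P \<ge> 2" using l by simp
  then have "l = tangent P" by (rule tangent_of_int_mult)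
  show ?thesis
    unfolding residual_def
  proof (rule the_equality)
    show "third P P \<in> fermat \<and> on_line (third P P) (tangent P) \<and> third P P \<noteq> P"
      using assms cut_by_line_on[OF l, of "third P P"] \<open>l = tangent P\<close> by simp
    fix R assume R: "R \<in> fermat \<and> on_line R (tangent P) \<and> R \<noteq> P"
    then have "int_mult l R > 0" using \<open>l = tangent P\<close> by (simp add: int_mult_pos_iff)
    then show "R = third P P" using R l by (auto split: if_splits)
  qed
qed

theorem theorem3:
  fixes E T :: cp2
  assumes "flex E" and "type9 E T"
  shows "type9 E (residual T) \<and> residual T \<noteq> T"
proof -
  define G where "G = fermat_group E"
  have E: "E \<in> fermat" using assms(1) by (simp add: flex_def)
  interpret comm_group G unfolding G_def using E by (rule comm_group_fermat_group)
  have carrier: "carrier G = fermat" and one: "\<one>\<^bsub>G\<^esub> = E"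
    by (simp_all add: G_def fermat_group_simps)
  have T: "T \<in> carrier G" "T [^]\<^bsub>G\<^esub> (9::nat) = \<one>\<^bsub>G\<^esub>" "T [^]\<^bsub>G\<^esub> (3::nat) \<noteq> \<one>\<^bsub>G\<^esub>"
    using assms(2) by (simp_all add: type9_def G_def)
  define R where "R = third T T"
  have R: "R \<in> carrier G" using T by (simp add: R_def carrier third_in_fermat)
  \<comment> \<open>\<open>R + T + T = 0\<close>, where the flex property of \<open>E\<close> enters through \<open>third E E = E\<close>.\<close>
  have "R \<otimes>\<^bsub>G\<^esub> (T \<otimes>\<^bsub>G\<^esub> T) = third E (third R (third E R))"
    by (simp add: G_def fermat_group_simps R_def)
  also have "\<dots> = \<one>\<^bsub>G\<^esub>"
    using R E third_flex[OF assms(1)]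
    by (simp add: carrier one third_commute[of E R] third_third)
  finally have inverse: "R = inv\<^bsub>G\<^esub> (T \<otimes>\<^bsub>G\<^esub> T)"
    using R T by (simp add: inv_equality)
  have pow: "R [^]\<^bsub>G\<^esub> n = inv\<^bsub>G\<^esub> (T [^]\<^bsub>G\<^esub> n \<otimes>\<^bsub>G\<^esub> T [^]\<^bsub>G\<^esub> n)" for n :: nat
    using T by (simp add: inverse nat_pow_inv pow_mult_distrib m_comm)
  \<comment> \<open>If \<open>3 R = - 2 y\<close> were \<open>0\<close>, then \<open>y = 3 y - 2 y = 0\<close>, since \<open>3 y = 9 T = 0\<close>.\<close>
  define y where "y = T [^]\<^bsub>G\<^esub> (3::nat)"
  have "y \<in> carrier G" "y \<noteq> \<one>\<^bsub>G\<^esub>" "y [^]\<^bsub>G\<^esub> (3::nat) = \<one>\<^bsub>G\<^esub>"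
    using T nat_pow_pow[of T 3 3] by (simp_all add: y_def)
  then have y: "y \<in> carrier G" "y \<noteq> \<one>\<^bsub>G\<^esub>" "y \<otimes>\<^bsub>G\<^esub> y \<otimes>\<^bsub>G\<^esub> y = \<one>\<^bsub>G\<^esub>"
    by (simp_all add: numeral_3_eq_3)
  have "R [^]\<^bsub>G\<^esub> (9::nat) = \<one>\<^bsub>G\<^esub>"
    using T by (simp add: pow)
  moreover have "R [^]\<^bsub>G\<^esub> (3::nat) \<noteq> \<one>\<^bsub>G\<^esub>"
  proof
    assume "R [^]\<^bsub>G\<^esub> (3::nat) = \<one>\<^bsub>G\<^esub>"
    then have "y \<otimes>\<^bsub>G\<^esub> y = \<one>\<^bsub>G\<^esub>"
      using y by (simp add: pow y_def[symmetric])
    then show False using y by simp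
  qed
  ultimately have type9: "type9 E R"
    using R by (simp add: type9_def G_def)
  have "R \<noteq> T"
  proof
    assume "R = T"
    then have "T \<otimes>\<^bsub>G\<^esub> (T \<otimes>\<^bsub>G\<^esub> T) = \<one>\<^bsub>G\<^esub>"
      using inverse T by (metis m_closed r_inv m_comm inv_closed)
    then show False using T by (simp add: numeral_3_eq_3 m_assoc)
  qed
  then have "residual T = R"
    using T residual_eq_third[of T] by (simp add: R_def carrier)
  then show ?thesis using type9 \<open>R \<noteq> T\<close> by simp
qed

end
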